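(* Let $X$ be a nonempty set and let $L$ be a truncated vector sublattice of $\mathbb{R}^{X}$. Any truncation homomorphism on $L$ is a lattice homomorphism on $L$.
   Context: $\mathbb{R}^{X}$ is the set of all real-valued functions on the nonempty set $X$, with pointwise vector space operations and pointwise order, so $(f\wedge g)(x)=\min\{f(x),g(x)\}$. $\mathbf{1}_{X}$ is the constant function $1$ on $X$. A vector sublattice of $\mathbb{R}^{X}$ is a linear subspace closed under pointwise minimum and maximum. A truncated vector sublattice of $\mathbb{R}^{X}$ is a vector sublattice $L$ of $\mathbb{R}^{X}$ such that $f\wedge\mathbf{1}_{X}\in L$ for all $f\in L$ (it is not assumed that $\mathbf{1}_{X}\in L$). A truncation homomorphism on $L$ is a nonzero linear functional $\psi:L\to\mathbb{R}$ such that $\psi(f\wedge\mathbf{1}_{X})=\min\{\psi(f),1\}$ for all $f\in L$. A linear functional $\psi$ on $L$ is a lattice homomorphism if $\psi(f\wedge g)=\min\{\psi(f),\psi(g)\}$ for all $f,g\in L$. *)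

theory Defs
  imports Complex_Main "HOL-Library.Function_Algebras"
begin

text \<open>
  The set \<open>X\<close> is the (automatically nonempty) type \<open>'x\<close>, so \<open>\<real>\<^sup>X\<close> is \<open>'x \<Rightarrow> real\<close>.
  Addition, order, \<open>inf\<close> and \<open>sup\<close> on this type are the pointwise library ones, and the
  constant function \<open>1\<close> is \<open>1 :: 'x \<Rightarrow> real\<close>. Only scalar multiplication is not
  available in the library.
\<close>

definition fun_scale :: "real \<Rightarrow> ('x \<Rightarrow> real) \<Rightarrow> ('x \<Rightarrow> real)"
  where "fun_scale c f = (\<lambda>x. c * f x)"

global_interpretation real_fun: vector_space "fun_scale :: real \<Rightarrow> ('x \<Rightarrow> real) \<Rightarrow> ('x \<Rightarrow> real)"
  by unfold_locales (auto simp: fun_scale_def fun_eq_iff algebra_simps)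

definition vector_sublattice :: "('x \<Rightarrow> real) set \<Rightarrow> bool"
  where "vector_sublattice L \<longleftrightarrow>
    real_fun.subspace L \<and> (\<forall>f\<in>L. \<forall>g\<in>L. inf f g \<in> L \<and> sup f g \<in> L)"

definition truncated_vector_sublattice :: "('x \<Rightarrow> real) set \<Rightarrow> bool"
  where "truncated_vector_sublattice L \<longleftrightarrow>
    vector_sublattice L \<and> (\<forall>f\<in>L. inf f 1 \<in> L)"

text \<open>
  A functional on \<open>L\<close> is a function on all of \<open>'x \<Rightarrow> real\<close> of which only the values on \<open>L\<close>
  matter: nothing is required of it outside \<open>L\<close>.
\<close>

definition linear_functional_on :: "('x \<Rightarrow> real) set \<Rightarrow> (('x \<Rightarrow> real) \<Rightarrow> real) \<Rightarrow> bool"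
  where "linear_functional_on L \<psi> \<longleftrightarrow>
    (\<forall>f\<in>L. \<forall>g\<in>L. \<psi> (f + g) = \<psi> f + \<psi> g) \<and>
    (\<forall>c. \<forall>f\<in>L. \<psi> (fun_scale c f) = c * \<psi> f)"

definition truncation_homomorphism_on :: "('x \<Rightarrow> real) set \<Rightarrow> (('x \<Rightarrow> real) \<Rightarrow> real) \<Rightarrow> bool"
  where "truncation_homomorphism_on L \<psi> \<longleftrightarrow>
    linear_functional_on L \<psi> \<and> (\<exists>f\<in>L. \<psi> f \<noteq> 0) \<and>
    (\<forall>f\<in>L. \<psi> (inf f 1) = min (\<psi> f) 1)"

definition lattice_homomorphism_on :: "('x \<Rightarrow> real) set \<Rightarrow> (('x \<Rightarrow> real) \<Rightarrow> real) \<Rightarrow> bool"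
  where "lattice_homomorphism_on L \<psi> \<longleftrightarrow>
    linear_functional_on L \<psi> \<and> (\<forall>f\<in>L. \<forall>g\<in>L. \<psi> (inf f g) = min (\<psi> f) (\<psi> g))"

lemma inf_fun_real: "inf f g x = min (f x) (g x)" for f g :: "'x \<Rightarrow> real"
  by (simp add: inf_min)

lemma sup_fun_real: "sup f g x = max (f x) (g x)" for f g :: "'x \<Rightarrow> real"
  by (simp add: sup_max)

end

theory Submission
  imports Defs
begin

text \<open>
  Since \<open>\<psi> (-n f) \<le> 1\<close> for all \<open>n\<close> whenever \<open>f \<ge> 0\<close>, the functional \<open>\<psi>\<close> is positive. If \<open>f, g \<ge> 0\<close> are
  disjoint and both had nonzero image, they could be scaled so that \<open>\<psi> f = \<psi> g = 1\<close>; applying \<open>\<psi>\<close>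
  to \<open>(f + g) \<and> 1 = f \<and> 1 + g \<and> 1\<close> would then give \<open>1 = 2\<close>. So \<open>\<psi>\<close> vanishes on the positive or on
  the negative part of each function, and \<open>f \<and> g = f - (f - g)\<^sup>+\<close>.
\<close>

context
  fixes L :: "('x \<Rightarrow> real) set" and \<psi> :: "('x \<Rightarrow> real) \<Rightarrow> real"
  assumes L: "truncated_vector_sublattice L"
    and \<psi>: "truncation_homomorphism_on L \<psi>"
begin

lemma scale_mem: "f \<in> L \<Longrightarrow> fun_scale c f \<in> L"
  using L real_fun.subspace_scale
  by (auto simp: truncated_vector_sublattice_def vector_sublattice_def)

lemma add_mem: "f \<in> L \<Longrightarrow> g \<in> L \<Longrightarrow> f + g \<in> L"
  using L real_fun.subspace_add
  by (auto simp: truncated_vector_sublattice_def vector_sublattice_def)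

lemma diff_mem: "f \<in> L \<Longrightarrow> g \<in> L \<Longrightarrow> f - g \<in> L"
  using L real_fun.subspace_diff
  by (auto simp: truncated_vector_sublattice_def vector_sublattice_def)

lemma zero_mem: "0 \<in> L"
  using L real_fun.subspace_0
  by (auto simp: truncated_vector_sublattice_def vector_sublattice_def)

lemma sup_mem: "f \<in> L \<Longrightarrow> g \<in> L \<Longrightarrow> sup f g \<in> L"
  using L by (auto simp: truncated_vector_sublattice_def vector_sublattice_def)

lemma truncation_mem: "f \<in> L \<Longrightarrow> inf f 1 \<in> L"
  using L by (auto simp: truncated_vector_sublattice_def)

lemma hom_add: "f \<in> L \<Longrightarrow> g \<in> L \<Longrightarrow> \<psi> (f + g) = \<psi> f + \<psi> g"
  using \<psi> by (auto simp: truncation_homomorphism_on_def linear_functional_on_def)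

lemma hom_scale: "f \<in> L \<Longrightarrow> \<psi> (fun_scale c f) = c * \<psi> f"
  using \<psi> by (auto simp: truncation_homomorphism_on_def linear_functional_on_def)

lemma hom_diff: "f \<in> L \<Longrightarrow> g \<in> L \<Longrightarrow> \<psi> (f - g) = \<psi> f - \<psi> g"
  using hom_add[of "f - g" g] diff_mem[of f g] by simp

lemma hom_truncation: "f \<in> L \<Longrightarrow> \<psi> (inf f 1) = min (\<psi> f) 1"
  using \<psi> by (auto simp: truncation_homomorphism_on_def)

lemma hom_nonneg:
  assumes "f \<in> L" and "\<And>x. f x \<ge> 0"
  shows "\<psi> f \<ge> 0"
proof (rule ccontr)
  assume "\<not> \<psi> f \<ge> 0"
  \<comment> \<open>This negative constant makes \<open>c * \<psi> f\<close> equal to 2, while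
    \<open>fun_scale c f\<close> stays below 0 and hence below 1.\<close>
  define c where "c = 2 / \<psi> f"
  have "c \<le> 0"
    using \<open>\<not> \<psi> f \<ge> 0\<close> by (simp add: c_def divide_nonneg_neg divide_nonneg_nonpos)
  then have "c * f x \<le> 0" for x
    using assms(2) by (simp add: mult_nonpos_nonneg)
  then have "c * f x \<le> 1" for x
    by (meson order_trans zero_le_one)
  \<comment> \<open>A function that is its own truncation has an image equal to its minimum with 1,
    so at most 1.\<close>
  then have "inf (fun_scale c f) 1 = fun_scale c f"
    by (simp add: fun_eq_iff fun_scale_def inf_min)
  then have "c * \<psi> f \<le> 1"
    using hom_truncation[OF scale_mem[OF assms(1)], of c]
    by (simp add: hom_scale assms(1))
  then show False
    using \<open>\<not> \<psi> f \<ge> 0\<close> by (simp add: c_def)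
qed

lemma hom_disjoint:
  assumes f: "f \<in> L" "\<And>x. f x \<ge> 0" and g: "g \<in> L" "\<And>x. g x \<ge> 0"
    and disjoint: "\<And>x. f x = 0 \<or> g x = 0"
  shows "\<psi> f = 0 \<or> \<psi> g = 0"
proof (rule ccontr)
  assume nonzero: "\<not> (\<psi> f = 0 \<or> \<psi> g = 0)"
  define f' where "f' = fun_scale (1 / \<psi> f) f"
  define g' where "g' = fun_scale (1 / \<psi> g) g"
  have mem: "f' \<in> L" "g' \<in> L"
    by (simp_all add: f'_def g'_def scale_mem f g)
  have one: "\<psi> f' = 1" "\<psi> g' = 1"
    using nonzero by (simp_all add: f'_def g'_def hom_scale f g)
  \<comment> \<open>At each point one summand is 0, and truncation fixes 0, so both sides reduce to
    the truncation of the other summand.\<close>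
  have "inf (f' + g') 1 x = (inf f' 1 + inf g' 1) x" for x
    using disjoint[of x] by (auto simp: f'_def g'_def fun_scale_def inf_min)
  then have "inf (f' + g') 1 = inf f' 1 + inf g' 1"
    by (simp add: fun_eq_iff)
  then have "min (\<psi> f' + \<psi> g') 1 = min (\<psi> f') 1 + min (\<psi> g') 1"
    by (metis mem add_mem truncation_mem hom_add hom_truncation)
  then show False
    by (simp add: one)
qed

text \<open>The images of the positive and negative parts are nonnegative, differ by
  \<open>\<psi> f\<close>, and one of them is 0 by disjointness. This forces them to be the positive
  and negative parts of the real number \<open>\<psi> f\<close>.\<close>

lemma hom_pos_part:
  assumes f: "f \<in> L"
  shows "\<psi> (sup f 0) = max (\<psi> f) 0"
proof -
  define p where "p = sup f 0"
  define n where "n = sup (fun_scale (-1) f) 0"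
  have mem: "p \<in> L" "n \<in> L"
    unfolding p_def n_def by (intro sup_mem scale_mem zero_mem f)+
  have nonneg: "p x \<ge> 0" "n x \<ge> 0" for x
    by (simp_all add: p_def n_def sup_max)
  have "p x = 0 \<or> n x = 0" for x
    by (auto simp: p_def n_def fun_scale_def sup_max)
  then have "\<psi> p = 0 \<or> \<psi> n = 0"
    using hom_disjoint mem nonneg by blast
  moreover have "p = f + n"
    by (auto simp: p_def n_def fun_eq_iff fun_scale_def sup_max)
  then have "\<psi> p = \<psi> f + \<psi> n"
    using hom_add f mem by metis
  moreover have "\<psi> p \<ge> 0" "\<psi> n \<ge> 0"
    using hom_nonneg mem nonneg by blast+
  ultimately show ?thesis
    unfolding p_def[symmetric] by linarith
qed

lemma hom_inf:
  assumes f: "f \<in> L" and g: "g \<in> L"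
  shows "\<psi> (inf f g) = min (\<psi> f) (\<psi> g)"
proof -
  \<comment> \<open>This rewrites the meet by a difference and a positive part, both of which
    \<open>\<psi>\<close> respects; the same identity in the reals then finishes.\<close>
  have "inf f g = f - sup (f - g) 0"
    by (auto simp: fun_eq_iff sup_max inf_min)
  then have "\<psi> (inf f g) = \<psi> f - max (\<psi> f - \<psi> g) 0"
    by (simp add: hom_diff hom_pos_part diff_mem sup_mem zero_mem f g)
  then show ?thesis
    by linarith
qed

end

theorem lemma2p3:
  fixes L :: "('x \<Rightarrow> real) set" and \<psi> :: "('x \<Rightarrow> real) \<Rightarrow> real"
  assumes "truncated_vector_sublattice L"
    and "truncation_homomorphism_on L \<psi>"
  shows "lattice_homomorphism_on L \<psi>"
  using assms hom_inf[OF assms]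
  by (auto simp: lattice_homomorphism_on_def truncation_homomorphism_on_def)

end
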